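(* For every integer $n\ge 2$, the $n$-grid $G_{n,n}$ has a spanning tree $T$ such that the average length of a fundamental cycle with respect to $T$ is at most $40\log_2 n$.
   Context: The $n$-grid $G_{n,n}$ is the Cartesian product of two $n$-vertex paths. If $T$ is a spanning tree of a graph $G$ and $e$ is an edge of $G$ not contained in $T$, the fundamental cycle associated with $e$ (with respect to $T$) is the cycle formed by $e$ and the unique path of $T$ joining the two end vertices of $e$. Its length is its number of edges. The average length of a fundamental cycle with respect to $T$ is the arithmetic mean of the lengths of the fundamental cycles associated with all edges of $G$ not contained in $T$. *)

theory Defs
  imports Complex_Main
begin

text \<open>
  Simple graphs are given by a vertex set and a set of two-element edges. The tree notion of the
  AFP entry Graph_Theory is about directed cycles (there a symmetric pair of arcs is a cycle), so
  it does not fit undirected graphs.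
\<close>

record 'a sgraph =
  vertices :: "'a set"
  edges :: "'a set set"

definition is_path :: "'a sgraph \<Rightarrow> 'a \<Rightarrow> 'a list \<Rightarrow> 'a \<Rightarrow> bool" where
  "is_path G u p v \<longleftrightarrow>
     p \<noteq> [] \<and> hd p = u \<and> last p = v \<and> set p \<subseteq> vertices G \<and> distinct p \<and>
     successively (\<lambda>x y. {x, y} \<in> edges G) p"

definition path_edges :: "'a list \<Rightarrow> 'a set set" where
  "path_edges p = {{p ! i, p ! Suc i} | i. Suc i < length p}"

definition is_cycle :: "'a sgraph \<Rightarrow> 'a list \<Rightarrow> bool" where
  "is_cycle G c \<longleftrightarrow>
     3 \<le> length c \<and> set c \<subseteq> vertices G \<and> distinct c \<and>
     successively (\<lambda>x y. {x, y} \<in> edges G) c \<and> {last c, hd c} \<in> edges G"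

definition is_connected :: "'a sgraph \<Rightarrow> bool" where
  "is_connected G \<longleftrightarrow>
     vertices G \<noteq> {} \<and> (\<forall>u\<in>vertices G. \<forall>v\<in>vertices G. \<exists>p. is_path G u p v)"

definition is_tree :: "'a sgraph \<Rightarrow> bool" where
  "is_tree G \<longleftrightarrow> is_connected G \<and> \<not> (\<exists>c. is_cycle G c)"

definition is_spanning_tree :: "'a sgraph \<Rightarrow> 'a sgraph \<Rightarrow> bool" where
  "is_spanning_tree T G \<longleftrightarrow>
     vertices T = vertices G \<and> edges T \<subseteq> edges G \<and> is_tree T"

definition path_graph :: "nat \<Rightarrow> nat sgraph" where
  "path_graph n = \<lparr>vertices = {..<n}, edges = {{i, Suc i} | i. Suc i < n}\<rparr>"

definition cartesian_product :: "'a sgraph \<Rightarrow> 'b sgraph \<Rightarrow> ('a \<times> 'b) sgraph" where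
  "cartesian_product G H =
     \<lparr>vertices = vertices G \<times> vertices H,
      edges = {{(u, x), (v, x)} | u v x. {u, v} \<in> edges G \<and> x \<in> vertices H} \<union>
              {{(u, x), (u, y)} | u x y. u \<in> vertices G \<and> {x, y} \<in> edges H}\<rparr>"

definition grid :: "nat \<Rightarrow> nat \<Rightarrow> (nat \<times> nat) sgraph" where
  "grid m n = cartesian_product (path_graph m) (path_graph n)"

text \<open>
  A fundamental cycle is represented by its edge set. This set does not depend on the direction in
  which the tree path is traversed, so the description is unique whenever \<open>T\<close> is a tree
  containing both ends of \<open>e\<close>.
\<close>

definition fundamental_cycle :: "'a sgraph \<Rightarrow> 'a set \<Rightarrow> 'a set set" where
  "fundamental_cycle T e =
     (THE C. \<exists>u v p. e = {u, v} \<and> is_path T u p v \<and> C = insert e (path_edges p))"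

definition average_fundamental_cycle_length :: "'a sgraph \<Rightarrow> 'a sgraph \<Rightarrow> real" where
  "average_fundamental_cycle_length G T =
     (\<Sum>e\<in>edges G - edges T. real (card (fundamental_cycle T e))) / real (card (edges G - edges T))"

end

theory Submission
  imports Defs
begin

text \<open>
  Split the square into four quadrants of half the side length, choose a tree in each of them
  recursively, and connect the four trees along a path on the four vertices around the centre.
  Every quadrant is entered through a single vertex, so the diameter satisfies
  \<open>D(2s) \<le> 2 D(s) + 3\<close> and is linear in the side length. Only \<open>O(s)\<close> grid edges
  join different quadrants of a square of side \<open>s\<close>, and each closes a cycle of length
  \<open>O(s)\<close>; hence each of the \<open>\<lceil>log\<^sub>2 n\<rceil>\<close> levels of the
  recursion contributes \<open>O(n\<^sup>2)\<close> to the total length, to be divided by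
  \<open>(n - 1)\<^sup>2\<close> fundamental cycles.
\<close>

section \<open>Paths, unique connectedness and fundamental cycles\<close>

definition joined :: "'a sgraph \<Rightarrow> nat \<Rightarrow> 'a \<Rightarrow> 'a \<Rightarrow> bool" where
  "joined T d u v \<longleftrightarrow> (\<exists>p. is_path T u p v \<and> length p \<le> Suc d)"

text \<open>
  Unique connectedness, unlike acyclicity, passes to joins of two trees by cutting paths at the
  joining edge; it also makes \<^const>\<open>fundamental_cycle\<close> well defined.
\<close>

definition uniquely_connected :: "'a sgraph \<Rightarrow> bool" where
  "uniquely_connected T \<longleftrightarrow> vertices T \<noteq> {} \<and> finite (vertices T) \<and> (\<forall>e\<in>edges T. e \<subseteq> vertices T) \<and>
     (\<forall>u\<in>vertices T. \<forall>v\<in>vertices T. \<exists>!p. is_path T u p v)"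

lemma uniquely_connectedI:
  assumes "vertices T \<noteq> {}" "finite (vertices T)" "\<And>e. e \<in> edges T \<Longrightarrow> e \<subseteq> vertices T"
    and "\<And>u v. \<lbrakk>u \<in> vertices T; v \<in> vertices T\<rbrakk> \<Longrightarrow> \<exists>p. is_path T u p v"
    and "\<And>u v p q. \<lbrakk>is_path T u p v; is_path T u q v\<rbrakk> \<Longrightarrow> p = q"
  shows "uniquely_connected T"
  unfolding uniquely_connected_def using assms by metis

lemma is_path_ends:
  assumes "is_path T u p v"
  shows "u \<in> vertices T" "v \<in> vertices T"
  using assms unfolding is_path_def by (meson hd_in_set last_in_set subsetD)+

lemma uniquely_connected_path_unique:
  assumes "uniquely_connected T" "is_path T u p v" "is_path T u q v"
  shows "p = q"
  using assms is_path_ends[OF assms(2)] unfolding uniquely_connected_def by metis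

lemma is_path_Nil [simp]: "\<not> is_path T u [] v"
  by (simp add: is_path_def)

lemma is_path_single [simp]: "is_path T u [a] v \<longleftrightarrow> a = u \<and> a = v \<and> u \<in> vertices T"
  by (auto simp: is_path_def)

lemma is_path_Cons_Cons:
  "is_path T u (a # b # q) v \<longleftrightarrow>
     a = u \<and> u \<in> vertices T \<and> {u, b} \<in> edges T \<and> u \<notin> set (b # q) \<and> is_path T b (b # q) v"
  by (auto simp: is_path_def)

lemma is_path_rev:
  assumes "is_path T u p v"
  shows "is_path T v (rev p) u"
  using assms unfolding is_path_def
  by (auto simp: hd_rev last_rev insert_commute)

lemma joined_mono: "joined T d u v \<Longrightarrow> d \<le> d' \<Longrightarrow> joined T d' u v"
  unfolding joined_def by (meson Suc_le_mono order_trans)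

lemma joined_sym: "joined T d u v \<Longrightarrow> joined T d v u"
  unfolding joined_def by (metis is_path_rev length_rev)

text \<open>This makes the edge set of a fundamental cycle independent of the end at which the tree
  path starts.\<close>

lemma path_edges_rev: "path_edges (rev p) = path_edges p"
proof -
  have "path_edges (rev p) \<subseteq> path_edges p" for p :: "'a list"
  proof
    fix e assume "e \<in> path_edges (rev p)"
    then obtain i where i: "Suc i < length p" "e = {rev p ! i, rev p ! Suc i}"
      by (auto simp: path_edges_def)
    define j where "j = length p - Suc (Suc i)"
    have "Suc j = length p - Suc i" "Suc j < length p" using i by (auto simp: j_def)
    moreover have "e = {p ! j, p ! Suc j}"
      using i calculation by (auto simp: rev_nth j_def)
    ultimately show "e \<in> path_edges p" by (auto simp: path_edges_def)
  qed
  from this[of p] this[of "rev p"] show ?thesis by simp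
qed

lemma card_path_edges_le: "finite (path_edges p) \<and> card (path_edges p) \<le> length p - 1"
proof -
  have "path_edges p = (\<lambda>i. {p ! i, p ! Suc i}) ` {..<length p - 1}"
    by (auto simp: path_edges_def)
  then show ?thesis using card_image_le[of "{..<length p - 1}"] by auto
qed

text \<open>The unordered pair can be read in two orientations. Unique connectedness leaves only
  \<open>p\<close> for the one and \<open>rev p\<close> for the other, and both have the same edge
  set, so the definite description has exactly one candidate.\<close>

lemma fundamental_cycle_eq:
  assumes "uniquely_connected T" "is_path T u p v"
  shows "fundamental_cycle T {u, v} = insert {u, v} (path_edges p)"
  unfolding fundamental_cycle_def
proof (rule the_equality)
  fix C
  assume "\<exists>u' v' q. {u, v} = {u', v'} \<and> is_path T u' q v' \<and> C = insert {u, v} (path_edges q)"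
  then obtain q where "is_path T u q v \<or> is_path T v q u" "C = insert {u, v} (path_edges q)"
    by (metis doubleton_eq_iff)
  moreover have "q = p \<or> q = rev p"
    using calculation assms is_path_rev uniquely_connected_path_unique by metis
  ultimately show "C = insert {u, v} (path_edges p)" using path_edges_rev by metis
qed (use assms in blast)

text \<open>Path lists count vertices: at most \<open>Suc d\<close> vertices means at most d edges,
  and the closing edge adds one.\<close>

lemma card_fundamental_cycle_le:
  assumes "uniquely_connected T" "joined T d u v"
  shows "card (fundamental_cycle T {u, v}) \<le> Suc d"
proof -
  obtain p where p: "is_path T u p v" "length p \<le> Suc d"
    using assms(2) by (auto simp: joined_def)
  \<comment> \<open>This guards the truncated subtraction in the bound
    \<open>length p - 1\<close>.\<close>
  have "p \<noteq> []" using p by auto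
  then have "card (insert {u, v} (path_edges p)) \<le> length p"
    using card_path_edges_le[of p] card_insert_le_m1[of "length p" "path_edges p" "{u,v}"]
    by simp
  with p fundamental_cycle_eq[OF assms(1) p(1)] show ?thesis by simp
qed

text \<open>A cycle without its closing edge is a path on at least three vertices, while the closing
  edge alone is a second path between the same ends.\<close>

lemma uniquely_connected_is_tree:
  assumes "uniquely_connected T"
  shows "is_tree T"
  unfolding is_tree_def
proof
  show "is_connected T"
    using assms unfolding is_connected_def uniquely_connected_def by blast
  show "\<nexists>c. is_cycle T c"
  proof
    assume "\<exists>c. is_cycle T c"
    then obtain c where c: "3 \<le> length c" "set c \<subseteq> vertices T" "distinct c"
       "successively (\<lambda>x y. {x, y} \<in> edges T) c" "{last c, hd c} \<in> edges T"
      unfolding is_cycle_def by blast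
    then have "is_path T (hd c) c (last c)" by (auto simp: is_path_def)
    moreover have "hd c \<noteq> last c"
      using c by (cases c) (auto simp: last_in_set)
    then have "is_path T (hd c) [hd c, last c] (last c)"
      using c is_path_ends[OF calculation] by (auto simp: is_path_Cons_Cons insert_commute)
    ultimately have "c = [hd c, last c]"
      using uniquely_connected_path_unique[OF assms] by blast
    then have "length c = 2" by (metis length_Cons list.size(3) numeral_2_eq_2)
    with c(1) show False by simp
  qed
qed

section \<open>Joining two disjoint trees by one edge\<close>

locale tree_join =
  fixes S T :: "'a sgraph" and x y :: 'a
  assumes S: "uniquely_connected S" and T: "uniquely_connected T"
    and disjoint: "vertices S \<inter> vertices T = {}"
    and x: "x \<in> vertices S" and y: "y \<in> vertices T"
begin

definition J :: "'a sgraph" where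
  "J = \<lparr>vertices = vertices S \<union> vertices T, edges = insert {x, y} (edges S \<union> edges T)\<rparr>"

lemma vertices_J [simp]: "vertices J = vertices S \<union> vertices T"
  and edges_J [simp]: "edges J = insert {x, y} (edges S \<union> edges T)"
  by (simp_all add: J_def)

lemma edge_subset: "e \<in> edges S \<Longrightarrow> e \<subseteq> vertices S" "e \<in> edges T \<Longrightarrow> e \<subseteq> vertices T"
  using S T by (auto simp: uniquely_connected_def)

lemma path_left: "is_path S u p v \<Longrightarrow> is_path J u p v"
  unfolding is_path_def by (auto elim: successively_mono)

lemma path_right: "is_path T u p v \<Longrightarrow> is_path J u p v"
  unfolding is_path_def by (auto elim: successively_mono)

lemma path_across:
  assumes "is_path S u p x" "is_path T y q v"
  shows "is_path J u (p @ q) v"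
  using assms disjoint unfolding is_path_def
  by (auto simp: successively_append_iff elim: successively_mono)

lemma joined_left: "joined S d u v \<Longrightarrow> joined J d u v"
  and joined_right: "joined T d u v \<Longrightarrow> joined J d u v"
  unfolding joined_def using path_left path_right by blast+

lemma joined_across:
  assumes "joined S d u x" "joined T d' y v"
  shows "joined J (Suc (d + d')) u v"
  using assms path_across unfolding joined_def by (fastforce)

text \<open>The only edge of \<open>J\<close> that leaves \<open>vertices T\<close> is {x, y}, and a
  path that misses x cannot use it.\<close>

lemma path_avoiding_x:
  assumes "is_path J u p v" "u \<in> vertices T" "x \<notin> set p"
  shows "is_path T u p v"
  using assms
proof (induction p arbitrary: u)
  case (Cons a q)
  show ?case
  proof (cases q)
    case Nil
    with Cons.prems show ?thesis by auto
  next
    case (Cons b r)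
    with Cons.prems have *: "a = u" "{u, b} \<in> edges J" "u \<notin> set (b # r)" "is_path J b q v"
        "x \<noteq> u" "x \<noteq> b" "x \<notin> set q"
      by (auto simp: is_path_Cons_Cons)
    then have "{u, b} \<in> edges T"
      using Cons.prems(2) disjoint edge_subset by (auto simp: doubleton_eq_iff)
    moreover have "b \<in> vertices T" using calculation edge_subset by blast
    ultimately show ?thesis
      using * Cons.IH[of b] Cons.prems Cons by (auto simp: is_path_Cons_Cons)
  qed
qed simp

text \<open>A path that starts in \<open>S\<close> can leave it only by the step from x to y. Since
  its vertices are distinct, it never meets x again, so \<open>path_avoiding_x\<close> keeps the
  rest inside \<open>T\<close>.\<close>

lemma path_from_left:
  assumes "is_path J u p v" "u \<in> vertices S"
  shows "is_path S u p v \<or> (\<exists>q r. p = q @ r \<and> is_path S u q x \<and> is_path T y r v)"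
  using assms
proof (induction p arbitrary: u)
  case (Cons a q)
  show ?case
  proof (cases q)
    case Nil
    with Cons.prems show ?thesis by auto
  next
    case q: (Cons b r)
    with Cons.prems have *: "a = u" "{u, b} \<in> edges J" "u \<notin> set q" "is_path J b q v"
      by (auto simp: is_path_Cons_Cons)
    show ?thesis
    proof (cases "b \<in> vertices S")
      case True
      then have e: "{u, b} \<in> edges S"
        using Cons.prems(2) * disjoint edge_subset(2)[of "{u, b}"] y
        by (auto simp: doubleton_eq_iff)
      from Cons.IH[OF *(4) True] show ?thesis
      proof
        assume "is_path S b q v"
        then show ?thesis using q * e Cons.prems by (auto simp: is_path_Cons_Cons)
      next
        assume "\<exists>q' r. q = q' @ r \<and> is_path S b q' x \<and> is_path T y r v"
        then obtain q' r' where qr: "q = q' @ r'" "is_path S b q' x" "is_path T y r' v" by blast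
        then obtain q'' where "q' = b # q''" using q by (cases q') auto
        then have "is_path S u (u # q') x"
          using qr e * Cons.prems by (auto simp: is_path_Cons_Cons)
        moreover have "a # q = (u # q') @ r'" using qr * by simp
        ultimately show ?thesis using qr by blast
      qed
    next
      case False
      then have xy: "u = x" "b = y"
        using * Cons.prems(2) edge_subset disjoint x y by (auto simp: doubleton_eq_iff)
      then have "is_path T y q v" using path_avoiding_x * y by blast
      moreover have "is_path S u [u] x" using xy x by simp
      moreover have "a # q = [u] @ q" using * by simp
      ultimately show ?thesis by blast
    qed
  qed
qed simp

text \<open>The side on which v lies decides which alternative of \<open>path_from_left\<close>
  holds. The pieces are then unique in their own trees, because the crossing point is
  forced.\<close>

lemma paths_from_left_unique:
  assumes "is_path J u p v" "is_path J u q v" "u \<in> vertices S"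
  shows "p = q"
proof (cases "v \<in> vertices S")
  case True
  then have "\<not> is_path T y r v" for r using is_path_ends(2) disjoint by fastforce
  then show ?thesis
    using path_from_left[OF assms(1,3)] path_from_left[OF assms(2,3)]
      uniquely_connected_path_unique[OF S] by blast
next
  case False
  then have "\<not> is_path S u r v" for r using is_path_ends(2) by fastforce
  then show ?thesis
    using path_from_left[OF assms(1,3)] path_from_left[OF assms(2,3)]
      uniquely_connected_path_unique[OF S] uniquely_connected_path_unique[OF T] by metis
qed

end

lemma tree_join_sym: "tree_join S T x y \<Longrightarrow> tree_join T S y x"
  by (auto simp: tree_join_def)

lemma tree_join_J_sym: "tree_join S T x y \<Longrightarrow> tree_join.J T S y x = tree_join.J S T x y"
  by (auto simp: tree_join.J_def tree_join_sym Un_commute insert_commute)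

context tree_join
begin

lemma uniquely_connected_J: "uniquely_connected J"
proof (rule uniquely_connectedI)
  show "vertices J \<noteq> {}" "finite (vertices J)"
    using S T by (auto simp: uniquely_connected_def)
  show "e \<subseteq> vertices J" if "e \<in> edges J" for e
    using that edge_subset x y by auto
  have across: "\<exists>p. is_path J u p v" if "u \<in> vertices S" "v \<in> vertices T" for u v
    using that S T x y path_across unfolding uniquely_connected_def by metis
  show "\<exists>p. is_path J u p v" if "u \<in> vertices J" "v \<in> vertices J" for u v
    using that across[of u v] across[of v u] is_path_rev path_left path_right S T
    unfolding uniquely_connected_def vertices_J by (metis UnE)
  \<comment> \<open>Uniqueness is known so far for paths starting in \<open>S\<close>. A path
    starting in \<open>T\<close> starts on the left of the swapped join, which is the same
    graph.\<close>
  interpret sym: tree_join T S y x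
    using tree_join_axioms by (rule tree_join_sym)
  have "sym.J = J" using tree_join_axioms by (rule tree_join_J_sym)
  then show "p = q" if "is_path J u p v" "is_path J u q v" for u v p q
    using that is_path_ends(1)[OF that(1)] paths_from_left_unique sym.paths_from_left_unique
    by (metis UnE vertices_J)
qed

text \<open>The path inside \<open>S\<close> is still the tree path in \<open>J\<close>. Hence a
  join does not change the cost of older edges, and costs simply add up over the recursion.\<close>

lemma fundamental_cycle_left:
  assumes "u \<in> vertices S" "v \<in> vertices S"
  shows "fundamental_cycle J {u, v} = fundamental_cycle S {u, v}"
proof -
  obtain p where "is_path S u p v" using assms S unfolding uniquely_connected_def by blast
  then show ?thesis
    using fundamental_cycle_eq S uniquely_connected_J path_left by metis
qed

lemma fundamental_cycle_right:
  assumes "u \<in> vertices T" "v \<in> vertices T"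
  shows "fundamental_cycle J {u, v} = fundamental_cycle T {u, v}"
proof -
  obtain p where "is_path T u p v" using assms T unfolding uniquely_connected_def by blast
  then show ?thesis
    using fundamental_cycle_eq T uniquely_connected_J path_right by metis
qed

text \<open>Few tree edges mean many non-tree edges: this invariant finally bounds the denominator
  of the average from below.\<close>

lemma card_edges_J:
  assumes "card (edges S) < card (vertices S)" "card (edges T) < card (vertices T)"
  shows "card (edges J) < card (vertices J)"
proof -
  have fin: "finite (vertices S)" "finite (vertices T)"
    using S T by (auto simp: uniquely_connected_def)
  then have "finite (edges S)" "finite (edges T)"
    using edge_subset by (meson PowI finite_Pow_iff finite_subset subsetI)+
  then have "card (edges J) \<le> Suc (card (edges S) + card (edges T))"
    using card_Un_le[of "edges S" "edges T"] by (simp add: card_insert_if)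
  moreover have "card (vertices J) = card (vertices S) + card (vertices T)"
    using fin disjoint by (simp add: card_Un_disjoint)
  ultimately show ?thesis using assms by linarith
qed

text \<open>Vertices on different sides meet through x and y, at distance at most D + 1 + D.
  Vertices on the same side keep their old path.\<close>

lemma diameter_J:
  assumes "\<forall>u\<in>vertices S. \<forall>v\<in>vertices S. joined S K u v"
    and "\<forall>u\<in>vertices T. \<forall>v\<in>vertices T. joined T K u v"
    and "\<forall>u\<in>vertices S. joined S D u x" "\<forall>v\<in>vertices T. joined T D v y" "2 * D + 1 \<le> K"
  shows "\<forall>u\<in>vertices J. \<forall>v\<in>vertices J. joined J K u v"
proof -
  have "joined J K u v" if "u \<in> vertices S" "v \<in> vertices T" for u v
  proof (rule joined_mono)
    show "joined J (Suc (D + D)) u v"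
      using that assms(3,4) by (blast intro: joined_across joined_sym)
  qed (use assms(5) in simp)
  then show ?thesis
    using assms(1,2) joined_left joined_right joined_sym vertices_J by (metis UnE)
qed

text \<open>From \<open>T\<close> the port x costs one edge more than y. Keeping the distance to a
  port apart from the diameter is what keeps the next join cheap.\<close>

lemma radius_J:
  assumes "\<forall>u\<in>vertices S. joined S D u x" "\<forall>v\<in>vertices T. joined T D v y"
  shows "\<forall>u\<in>vertices J. joined J (Suc D) u x"
proof -
  have "joined S 0 x x" using x by (auto simp: joined_def intro!: exI[of _ "[x]"])
  then have "joined J (Suc D) x v" if "v \<in> vertices T" for v
    using joined_across[of 0 x D v] joined_sym that assms(2) by fastforce
  then show ?thesis
    using assms(1) joined_left joined_sym joined_mono
    by (metis UnE vertices_J le_add2 plus_1_eq_Suc)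
qed

end

section \<open>Trees with bounded diameter and total cycle length\<close>

text \<open>
  The last conjunct sums over all of \<open>E\<close>, tree edges included, so that costs add up under joins.
\<close>

definition cheap_tree :: "'a sgraph \<Rightarrow> 'a set \<Rightarrow> 'a set set \<Rightarrow> nat \<Rightarrow> nat \<Rightarrow> bool" where
  "cheap_tree T V E K N \<longleftrightarrow>
     uniquely_connected T \<and> vertices T = V \<and> edges T \<subseteq> E \<and> card (edges T) < card V \<and>
     finite E \<and> (\<forall>e\<in>E. \<exists>u\<in>V. \<exists>v\<in>V. e = {u, v}) \<and>
     (\<forall>u\<in>V. \<forall>v\<in>V. joined T K u v) \<and>
     (\<Sum>e\<in>E. card (fundamental_cycle T e)) \<le> N"

lemma cheap_tree_mono:
  assumes "cheap_tree T V E K N" "K \<le> K'" "N \<le> N'"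
  shows "cheap_tree T V E K' N'"
  using assms joined_mono unfolding cheap_tree_def by (metis order_trans)

lemma sum_Un_le:
  fixes f :: "'a \<Rightarrow> nat"
  assumes "finite A" "finite B"
  shows "sum f (A \<union> B) \<le> sum f A + sum f B"
  using sum.union_inter[OF assms, of f] by linarith

text \<open>Edges of E and F keep their cycles. An edge of C closes a cycle through {x, y}: at most
  2 * D + 1 tree edges and the edge itself, which explains the factor 2 * D + 2.\<close>

lemma cheap_tree_join:
  assumes S: "cheap_tree S V E K M" and T: "cheap_tree T W F K N"
    and "V \<inter> W = {}" "x \<in> V" "y \<in> W"
    and C: "finite C" "card C \<le> L" "{x, y} \<in> C" "\<forall>e\<in>C. \<exists>u\<in>V. \<exists>v\<in>W. e = {u, v}"
    and r: "\<forall>u\<in>V. joined S D u x" "\<forall>v\<in>W. joined T D v y" "2 * D + 1 \<le> K"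
  shows "\<exists>J. cheap_tree J (V \<union> W) (E \<union> F \<union> C) K (M + N + L * (2 * D + 2)) \<and>
             (\<forall>u\<in>V \<union> W. joined J (Suc D) u x)"
proof -
  have VW: "vertices S = V" "vertices T = W"
    and diam: "\<forall>u\<in>V. \<forall>v\<in>V. joined S K u v" "\<forall>u\<in>W. \<forall>v\<in>W. joined T K u v"
    and pairs: "\<forall>e\<in>E. \<exists>u\<in>V. \<exists>v\<in>V. e = {u, v}" "\<forall>e\<in>F. \<exists>u\<in>W. \<exists>v\<in>W. e = {u, v}"
    and fin: "finite E" "finite F"
    and sub: "edges S \<subseteq> E" "edges T \<subseteq> F"
    and small: "card (edges S) < card V" "card (edges T) < card W"
    and costs: "(\<Sum>e\<in>E. card (fundamental_cycle S e)) \<le> M"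
      "(\<Sum>e\<in>F. card (fundamental_cycle T e)) \<le> N"
    using S T unfolding cheap_tree_def by blast+
  interpret tree_join S T x y
    using S T assms(3-5) unfolding cheap_tree_def by unfold_locales auto
  let ?c = "\<lambda>e. card (fundamental_cycle J e)"
  have "sum ?c E = (\<Sum>e\<in>E. card (fundamental_cycle S e))"
    using pairs(1) fundamental_cycle_left unfolding VW by (intro sum.cong refl) metis
  moreover have "sum ?c F = (\<Sum>e\<in>F. card (fundamental_cycle T e))"
    using pairs(2) fundamental_cycle_right unfolding VW by (intro sum.cong refl) metis
  moreover have "?c e \<le> 2 * D + 2" if "e \<in> C" for e
  proof -
    obtain u v where uv: "u \<in> V" "v \<in> W" "e = {u, v}" using C(4) \<open>e \<in> C\<close> by blast
    then have "joined J (Suc (D + D)) u v"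
      using r by (blast intro: joined_across joined_sym)
    then show ?thesis
      using card_fundamental_cycle_le[OF uniquely_connected_J] uv(3) by fastforce
  qed
  then have "sum ?c C \<le> card C * (2 * D + 2)"
    using sum_bounded_above[of C ?c "2 * D + 2"] by simp
  then have "sum ?c C \<le> L * (2 * D + 2)"
    using C(2) by (meson mult_le_mono1 order_trans)
  moreover have "sum ?c (E \<union> F \<union> C) \<le> sum ?c E + sum ?c F + sum ?c C"
    using sum_Un_le[of "E \<union> F" C ?c] sum_Un_le[of E F ?c] fin C(1) by simp
  ultimately have "sum ?c (E \<union> F \<union> C) \<le> M + N + L * (2 * D + 2)"
    using costs by linarith
  moreover have "\<forall>e\<in>E \<union> F \<union> C. \<exists>u\<in>V \<union> W. \<exists>v\<in>V \<union> W. e = {u, v}"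
    unfolding ball_Un using pairs C(4) by (intro conjI) (meson UnI1 UnI2)+
  ultimately have "cheap_tree J (V \<union> W) (E \<union> F \<union> C) K (M + N + L * (2 * D + 2))"
    using uniquely_connected_J sub C(1,3) fin card_edges_J[unfolded VW, OF small]
      diameter_J[unfolded VW, OF diam r]
    unfolding cheap_tree_def by (intro conjI) (auto simp: VW)
  moreover have "\<forall>u\<in>V \<union> W. joined J (Suc D) u x"
    using radius_J[of D] r VW by simp
  ultimately show ?thesis by blast
qed

lemma cheap_tree_single: "\<exists>T. cheap_tree T {w} {} 0 0"
proof
  let ?T = "\<lparr>vertices = {w}, edges = {}\<rparr>"
  have path: "is_path ?T u p v \<longleftrightarrow> p = [w] \<and> u = w \<and> v = w" for u p v
    by (cases p; cases "tl p") (auto simp: is_path_Cons_Cons)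
  then show "cheap_tree ?T {w} {} 0 0"
    by (auto simp: cheap_tree_def uniquely_connected_def joined_def)
qed

section \<open>Edges of grid rectangles\<close>

definition rect_edges :: "nat \<Rightarrow> nat \<Rightarrow> nat \<Rightarrow> nat \<Rightarrow> (nat \<times> nat) set set" where
  "rect_edges a b c d =
     (\<lambda>(i, j). {(i, j), (Suc i, j)}) ` ({a..<b} \<times> {c..d}) \<union>
     (\<lambda>(i, j). {(i, j), (i, Suc j)}) ` ({a..b} \<times> {c..<d})"

lemma rect_edges_split_first:
  assumes "a \<le> m" "m < b"
  shows "rect_edges a b c d =
    rect_edges a m c d \<union> rect_edges (Suc m) b c d \<union> (\<lambda>j. {(m, j), (Suc m, j)}) ` {c..d}"
proof -
  have "{a..<b} = {a..<m} \<union> {Suc m..<b} \<union> {m}" "{a..b} = {a..m} \<union> {Suc m..b}"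
    using assms by auto
  then show ?thesis unfolding rect_edges_def by (simp only: Sigma_Un_distrib1 image_Un) auto
qed

lemma rect_edges_split_second:
  assumes "c \<le> m" "m < d"
  shows "rect_edges a b c d =
    rect_edges a b c m \<union> rect_edges a b (Suc m) d \<union> (\<lambda>i. {(i, m), (i, Suc m)}) ` {a..b}"
proof -
  have "{c..<d} = {c..<m} \<union> {Suc m..<d} \<union> {m}" "{c..d} = {c..m} \<union> {Suc m..d}"
    using assms by auto
  then show ?thesis unfolding rect_edges_def by (simp only: Sigma_Un_distrib2 image_Un) auto
qed

lemma edges_grid: "edges (grid (Suc m) (Suc n)) = rect_edges 0 m 0 n"
proof -
  have "{{(u, x), (v, x)} | u v x.
        {u, v} \<in> edges (path_graph (Suc m)) \<and> x \<in> vertices (path_graph (Suc n))} =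
      (\<lambda>(i, j). {(i, j), (Suc i, j)}) ` ({0..<m} \<times> {0..n})" (is "?A = ?B")
  proof
    show "?A \<subseteq> ?B"
      by (force simp: path_graph_def doubleton_eq_iff image_iff)
    show "?B \<subseteq> ?A" by (fastforce simp: path_graph_def)
  qed
  moreover have "{{(u, x), (u, y)} | u x y.
        u \<in> vertices (path_graph (Suc m)) \<and> {x, y} \<in> edges (path_graph (Suc n))} =
      (\<lambda>(i, j). {(i, j), (i, Suc j)}) ` ({0..m} \<times> {0..<n})" (is "?C = ?D")
  proof
    show "?C \<subseteq> ?D"
      by (force simp: path_graph_def doubleton_eq_iff image_iff)
    show "?D \<subseteq> ?C" by (fastforce simp: path_graph_def)
  qed
  ultimately show ?thesis unfolding grid_def cartesian_product_def rect_edges_def by simp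
qed

section \<open>Recursive construction on rectangles\<close>

lemma cheap_tree_join_first:
  assumes S: "cheap_tree S ({a..m} \<times> {c..d}) (rect_edges a m c d) K M"
    and T: "cheap_tree T ({Suc m..b} \<times> {c..d}) (rect_edges (Suc m) b c d) K N"
    and "a \<le> m" "m < b" "r \<in> {c..d}" "d - c < L" "2 * D + 1 \<le> K"
    and "\<forall>u\<in>{a..m} \<times> {c..d}. joined S D u (m, r)"
    and "\<forall>u\<in>{Suc m..b} \<times> {c..d}. joined T D u (Suc m, r)"
  shows "\<exists>J. cheap_tree J ({a..b} \<times> {c..d}) (rect_edges a b c d) K (M + N + L * (2 * D + 2)) \<and>
             (\<forall>u\<in>{a..b} \<times> {c..d}. joined J (Suc D) u (m, r))"
proof -
  have "{a..b} \<times> {c..d} = {a..m} \<times> {c..d} \<union> {Suc m..b} \<times> {c..d}"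
    using assms(3,4) by auto
  moreover have "\<forall>e\<in>(\<lambda>j. {(m, j), (Suc m, j)}) ` {c..d}.
      \<exists>u\<in>{a..m} \<times> {c..d}. \<exists>v\<in>{Suc m..b} \<times> {c..d}. e = {u, v}"
  proof
    fix e assume "e \<in> (\<lambda>j. {(m, j), (Suc m, j)}) ` {c..d}"
    then obtain j where "j \<in> {c..d}" "e = {(m, j), (Suc m, j)}" by blast
    then show "\<exists>u\<in>{a..m} \<times> {c..d}. \<exists>v\<in>{Suc m..b} \<times> {c..d}. e = {u, v}"
      using assms(3,4) by (intro bexI[of _ "(m, j)"] bexI[of _ "(Suc m, j)"]) auto
  qed
  moreover have "card ((\<lambda>j. {(m, j), (Suc m, j)}) ` {c..d}) \<le> L"
    using card_image_le[of "{c..d}" "\<lambda>j. {(m, j), (Suc m, j)}"] \<open>d - c < L\<close> by auto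
  ultimately show ?thesis
    unfolding rect_edges_split_first[OF assms(3,4)] using assms(3-9)
    by (simp only:) (rule cheap_tree_join[OF S T]; (assumption | force))
qed

lemma cheap_tree_join_second:
  assumes S: "cheap_tree S ({a..b} \<times> {c..m}) (rect_edges a b c m) K M"
    and T: "cheap_tree T ({a..b} \<times> {Suc m..d}) (rect_edges a b (Suc m) d) K N"
    and "c \<le> m" "m < d" "r \<in> {a..b}" "b - a < L" "2 * D + 1 \<le> K"
    and "\<forall>u\<in>{a..b} \<times> {c..m}. joined S D u (r, m)"
    and "\<forall>u\<in>{a..b} \<times> {Suc m..d}. joined T D u (r, Suc m)"
  shows "\<exists>J. cheap_tree J ({a..b} \<times> {c..d}) (rect_edges a b c d) K (M + N + L * (2 * D + 2)) \<and>
             (\<forall>u\<in>{a..b} \<times> {c..d}. joined J (Suc D) u (r, m))"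
proof -
  have "{a..b} \<times> {c..d} = {a..b} \<times> {c..m} \<union> {a..b} \<times> {Suc m..d}"
    using assms(3,4) by auto
  moreover have "\<forall>e\<in>(\<lambda>i. {(i, m), (i, Suc m)}) ` {a..b}.
      \<exists>u\<in>{a..b} \<times> {c..m}. \<exists>v\<in>{a..b} \<times> {Suc m..d}. e = {u, v}"
  proof
    fix e assume "e \<in> (\<lambda>i. {(i, m), (i, Suc m)}) ` {a..b}"
    then obtain i where "i \<in> {a..b}" "e = {(i, m), (i, Suc m)}" by blast
    then show "\<exists>u\<in>{a..b} \<times> {c..m}. \<exists>v\<in>{a..b} \<times> {Suc m..d}. e = {u, v}"
      using assms(3,4) by (intro bexI[of _ "(i, m)"] bexI[of _ "(i, Suc m)"]) auto
  qed
  moreover have "card ((\<lambda>i. {(i, m), (i, Suc m)}) ` {a..b}) \<le> L"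
    using card_image_le[of "{a..b}" "\<lambda>i. {(i, m), (i, Suc m)}"] \<open>b - a < L\<close> by auto
  ultimately show ?thesis
    unfolding rect_edges_split_second[OF assms(3,4)] using assms(3-9)
    by (simp only:) (rule cheap_tree_join[OF S T]; (assumption | force))
qed

text \<open>Rectangles with at most 2^k vertices per side, instead of squares, allow halving when a
  side is odd or already a single vertex. The bounds solve D(k+1) = 2 D(k) + 3 with D(0) = 0, and
  N(k+1) = 4 N(k) + 24 * 4^k with N(0) = 0.\<close>

lemma cheap_rect_tree:
  assumes "a \<le> b" "c \<le> d" "b - a < 2 ^ k" "d - c < 2 ^ k"
  shows "\<exists>T. cheap_tree T ({a..b} \<times> {c..d}) (rect_edges a b c d) (3 * 2 ^ k - 3) (6 * k * 4 ^ k)"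
  using assms
proof (induction k arbitrary: a b c d)
  case 0
  then have "a = b" "c = d" by auto
  then show ?case using cheap_tree_single[of "(b, d)"] by (simp add: rect_edges_def)
next
  case (Suc k)
  define P :: nat where "P = 2 ^ k"
  define D where "D = 3 * P - 3"
  have "P \<ge> 1" by (simp add: P_def)
  then have D: "D + 3 = 3 * P" by (simp add: D_def)
  have P4: "(4::nat) ^ k = P * P" by (simp add: P_def flip: power_mult_distrib)
  \<comment> \<open>Both halves use this same m, so that their ports (l, m) and (Suc l, m) are
    adjacent.\<close>
  define m where "m = (c + d) div 2"
  have m: "c \<le> m" "m \<le> d" using Suc.prems by (auto simp: m_def)
  \<comment> \<open>The upper and lower quadrants of one half, joined along the column that contains the port
    \<open>(r, m)\<close> towards the other half.\<close>
  have strip: "\<exists>T. cheap_tree T ({a..b} \<times> {c..d}) (rect_edges a b c d) (2 * D + 1)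
        ((12 * k + 6) * (P * P)) \<and> (\<forall>u\<in>{a..b} \<times> {c..d}. joined T (Suc D) u (r, m))"
    if ab: "a \<le> b" "b - a < P" and r: "r \<in> {a..b}" for a b r
  proof (cases "c = d")
    \<comment> \<open>There is nothing to cut in this direction; the diameter bound D already covers
      the distance to the port.\<close>
    case True
    obtain T where T: "cheap_tree T ({a..b} \<times> {c..d}) (rect_edges a b c d) D (6 * k * (P * P))"
      using Suc.IH[of a b c d] ab True by (auto simp: D_def P_def P4)
    then have "cheap_tree T ({a..b} \<times> {c..d}) (rect_edges a b c d) (2 * D + 1)
        ((12 * k + 6) * (P * P))"
      by (rule cheap_tree_mono) (auto intro: mult_le_mono1)
    moreover have "\<forall>u\<in>{a..b} \<times> {c..d}. joined T D u (r, m)"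
      using T m r by (auto simp: cheap_tree_def)
    ultimately show ?thesis using joined_mono[of T D _ _ "Suc D"] by auto
  next
    case False
    then have cd: "m < d" "m - c < P" "d - Suc m < P"
      using Suc.prems by (auto simp: m_def P_def)
    obtain S where S: "cheap_tree S ({a..b} \<times> {c..m}) (rect_edges a b c m) D (6 * k * (P * P))"
      using Suc.IH[of a b c m] ab cd m by (auto simp: D_def P_def P4)
    obtain T where T: "cheap_tree T ({a..b} \<times> {Suc m..d}) (rect_edges a b (Suc m) d) D
        (6 * k * (P * P))"
      using Suc.IH[of a b "Suc m" d] ab cd by (auto simp: D_def P_def P4)
    have "\<forall>u\<in>{a..b} \<times> {c..m}. joined S D u (r, m)"
      "\<forall>u\<in>{a..b} \<times> {Suc m..d}. joined T D u (r, Suc m)"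
      using S T r m cd by (auto simp: cheap_tree_def)
    then obtain J where J: "cheap_tree J ({a..b} \<times> {c..d}) (rect_edges a b c d) (2 * D + 1)
        (6 * k * (P * P) + 6 * k * (P * P) + P * (2 * D + 2))"
        "\<forall>u\<in>{a..b} \<times> {c..d}. joined J (Suc D) u (r, m)"
      using cheap_tree_join_second[of S a b c m "2 * D + 1" _ T d _ r P D,
          OF cheap_tree_mono[OF S _ order_refl] cheap_tree_mono[OF T _ order_refl]] m cd ab r
      by auto
    \<comment> \<open>By \<open>D + 3 = 3 * P\<close>, each of the at most P crossing edges costs at
      most 6 P.\<close>
    have "P * (2 * D + 2) \<le> P * (6 * P)" using D by (intro mult_le_mono2) simp
    then have "6 * k * (P * P) + 6 * k * (P * P) + P * (2 * D + 2) \<le> (12 * k + 6) * (P * P)"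
      by (simp add: algebra_simps)
    then show ?thesis using J cheap_tree_mono by blast
  qed
  \<comment> \<open>Each strip has radius \<open>Suc D\<close> about its port, so the second join
    yields diameter 2 (D + 1) + 1 = 2 D + 3.\<close>
  have K: "3 * 2 ^ Suc k - 3 = 2 * Suc D + 1" using D by (simp add: P_def)
  have N: "6 * Suc k * 4 ^ Suc k = 24 * Suc k * (P * P)" by (simp add: P4)
  show ?case
  proof (cases "a = b")
    case True
    with strip[of a b a] Suc.prems \<open>P \<ge> 1\<close> obtain T where
      "cheap_tree T ({a..b} \<times> {c..d}) (rect_edges a b c d) (2 * D + 1) ((12 * k + 6) * (P * P))"
      by auto
    then have "cheap_tree T ({a..b} \<times> {c..d}) (rect_edges a b c d) (2 * Suc D + 1)
        (24 * Suc k * (P * P))"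
      by (rule cheap_tree_mono) (auto intro: mult_le_mono1)
    then show ?thesis unfolding K N by blast
  next
    case False
    define l where "l = (a + b) div 2"
    have l: "a \<le> l" "l < b" "l - a < P" "b - Suc l < P"
      using Suc.prems False by (auto simp: l_def P_def)
    obtain S where S: "cheap_tree S ({a..l} \<times> {c..d}) (rect_edges a l c d) (2 * D + 1)
        ((12 * k + 6) * (P * P))"
      "\<forall>u\<in>{a..l} \<times> {c..d}. joined S (Suc D) u (l, m)"
      using strip[of a l l] l by auto
    obtain T where T: "cheap_tree T ({Suc l..b} \<times> {c..d}) (rect_edges (Suc l) b c d)
        (2 * D + 1) ((12 * k + 6) * (P * P))"
      "\<forall>u\<in>{Suc l..b} \<times> {c..d}. joined T (Suc D) u (Suc l, m)"
      using strip[of "Suc l" b "Suc l"] l by auto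
    obtain J where J: "cheap_tree J ({a..b} \<times> {c..d}) (rect_edges a b c d) (2 * Suc D + 1)
        ((12 * k + 6) * (P * P) + (12 * k + 6) * (P * P) + (2 * P) * (2 * Suc D + 2))"
      using cheap_tree_join_first[of S a l c d "2 * Suc D + 1" _ T b _ m "2 * P" "Suc D",
          OF cheap_tree_mono[OF S(1) _ order_refl] cheap_tree_mono[OF T(1) _ order_refl]]
        m l S(2) T(2) Suc.prems(4) P_def
      by auto
    \<comment> \<open>Up to 2 P edges cross between the strips, adding at most 12 P^2. With 6 P^2
      from each strip, the level costs at most 24 P^2.\<close>
    have "(2 * P) * (2 * Suc D + 2) \<le> (2 * P) * (6 * P)" using D by (intro mult_le_mono2) simp
    then have "(12 * k + 6) * (P * P) + (12 * k + 6) * (P * P) + (2 * P) * (2 * Suc D + 2)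
        \<le> 24 * Suc k * (P * P)"
      by (simp add: algebra_simps)
    then show ?thesis unfolding K N using J cheap_tree_mono by blast
  qed
qed

section \<open>Edge count and the logarithmic bound\<close>

lemma card_rect_edges: "card (rect_edges 0 m 0 m) = 2 * m * Suc m"
proof -
  let ?f = "\<lambda>(i::nat, j::nat). {(i, j), (Suc i, j)}"
    and ?g = "\<lambda>(i::nat, j::nat). {(i, j), (i, Suc j)}"
  have "inj ?f" "inj ?g" by (auto simp: inj_def doubleton_eq_iff)
  then have "card (?f ` ({0..<m} \<times> {0..m})) = m * Suc m"
      "card (?g ` ({0..m} \<times> {0..<m})) = m * Suc m"
    by (simp_all add: card_image inj_on_subset[of _ UNIV])
  moreover have "?f ` ({0..<m} \<times> {0..m}) \<inter> ?g ` ({0..m} \<times> {0..<m}) = {}"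
    by (auto simp: doubleton_eq_iff)
  ultimately show ?thesis unfolding rect_edges_def by (subst card_Un_disjoint) auto
qed

theorem corollary2:
  fixes n :: nat
  assumes "n \<ge> 2"
  shows "\<exists>T. is_spanning_tree T (grid n n) \<and>
             average_fundamental_cycle_length (grid n n) T \<le> 40 * log 2 (real n)"
proof -
  \<comment> \<open>Measuring n - 1 instead of n serves both ends: n vertices per side fit into
    2^(m+1), and (n - 1)^2 >= 4^m bounds the number of non-tree edges.\<close>
  obtain m where m: "2 ^ m \<le> n - 1" "n - 1 < 2 ^ Suc m"
    using ex_power_ivl1[of 2 "n - 1"] assms by fastforce
  define l where "l = n - 1"
  have n: "n = Suc l" using assms by (simp add: l_def)
  obtain T where T: "cheap_tree T ({0..l} \<times> {0..l}) (rect_edges 0 l 0 l)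
      (3 * 2 ^ Suc m - 3) (6 * Suc m * 4 ^ Suc m)"
    using cheap_rect_tree[of 0 l 0 l "Suc m"] m by (auto simp: l_def)
  have G: "edges (grid n n) = rect_edges 0 l 0 l" "vertices (grid n n) = {0..l} \<times> {0..l}"
    by (auto simp: n edges_grid, auto simp: grid_def cartesian_product_def path_graph_def)
  have T': "uniquely_connected T" "vertices T = vertices (grid n n)" "edges T \<subseteq> edges (grid n n)"
    and fin: "finite (edges (grid n n))" and few: "card (edges T) < card ({0..l} \<times> {0..l})"
    and cost: "(\<Sum>e\<in>edges (grid n n). card (fundamental_cycle T e)) \<le> 6 * Suc m * 4 ^ Suc m"
    using T unfolding G cheap_tree_def by auto
  let ?F = "edges (grid n n) - edges T"
  have "card ?F = 2 * l * Suc l - card (edges T)"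
    using T'(3) fin card_rect_edges G(1) by (simp add: card_Diff_subset finite_subset)
  moreover have "card (edges T) \<le> l * l + 2 * l"
    using few by (simp add: card_cartesian_product)
  \<comment> \<open>Here 2 l (l + 1) - (l^2 + 2 l) = l^2.\<close>
  ultimately have F: "l * l \<le> card ?F" by simp
  have l: "2 ^ m \<le> l" using m by (simp add: l_def)
  have "(4::nat) ^ m = 2 ^ m * 2 ^ m" by (simp flip: power_mult_distrib)
  also have "\<dots> \<le> l * l" using l by (rule mult_le_mono) (rule l)
  finally have F4: "4 ^ m \<le> card ?F" using F by linarith
  have "(\<Sum>e\<in>?F. card (fundamental_cycle T e)) \<le> 24 * Suc m * 4 ^ m"
    using sum_mono2[OF fin, of ?F "\<lambda>e. card (fundamental_cycle T e)"] cost
    by (auto simp: algebra_simps)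
  also have "\<dots> \<le> 24 * Suc m * card ?F" using F4 by simp
  finally have "(\<Sum>e\<in>?F. card (fundamental_cycle T e)) \<le> 24 * Suc m * card ?F" .
  then have "real (\<Sum>e\<in>?F. card (fundamental_cycle T e)) \<le> real (24 * Suc m * card ?F)"
    by (simp only: of_nat_le_iff)
  moreover have "card ?F > 0" using F4 by (metis less_le_trans zero_less_numeral zero_less_power)
  ultimately have "average_fundamental_cycle_length (grid n n) T \<le> 24 * real (Suc m)"
    unfolding average_fundamental_cycle_length_def by (simp add: divide_le_eq algebra_simps)
  also have "\<dots> \<le> 40 * log 2 (real n)"
  proof -
    define z where "z = log 2 (real n)"
    have z_ge: "x \<le> z" if "2 powr x \<le> real n" for x
      using that assms by (simp add: le_log_iff z_def)
    \<comment> \<open>From 2^m <= n the bound 24 (m + 1) <= 40 m follows only for m >= 2. The small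
      cases use n >= 2 and n >= 3.\<close>
    consider "m = 0" | "m = 1" | "m \<ge> 2" by linarith
    then have "24 * real (Suc m) \<le> 40 * z"
    proof cases
      case 1
      then show ?thesis using z_ge[of 1] assms by simp
    next
      case 2
      \<comment> \<open>For m = 1 the claim is 48 <= 40 z, hence the constant 6/5. It lies below
        log2 3 because 2^6 = 64 <= 243 = 3^5.\<close>
      have "(2 powr (6 / 5)) ^ 5 = (2::real) powr 6" by (simp add: powr_power)
      then have "(2 powr (6 / 5)) ^ Suc 4 \<le> (3::real) ^ Suc 4" by simp
      then have "2 powr (6 / 5) \<le> (3::real)" by (rule power_le_imp_le_base) simp
      moreover have "3 \<le> real n" using 2 l n by simp
      ultimately have "6 / 5 \<le> z" by (intro z_ge) linarith
      with 2 show ?thesis by simp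
    next
      case 3
      have "2 ^ m \<le> n" using l n by simp
      then have "real (2 ^ m) \<le> real n" by (simp only: of_nat_le_iff)
      then have "real m \<le> z" by (intro z_ge) (simp add: powr_realpow)
      with 3 show ?thesis by simp
    qed
    then show ?thesis by (simp only: z_def)
  qed
  finally show ?thesis
    using T' uniquely_connected_is_tree unfolding is_spanning_tree_def by blast
qed

end
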